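(* Let $\mu:\mathcal{C}\to\mathbb{R}_0^+$ and $\nu_1,\nu_2:\mathcal{E}\to\mathbb{R}_0^+$ be set functions vanishing on the empty set, and let $f:S\to\mathbb{R}_0^+$ be $\mu$-measurable. If $A\in\mathcal{C}$ is such that $f\in G_{RL}(\nu_i,\mu,A)$ for $i=1,2$, then $f\in G_{RL}(\nu_1+\nu_2,\mu,A)$ and $$\int_A^{*} f\,d(\nu_1+\nu_2,\mu)=\int_A^{*} f\,d(\nu_1,\mu)+\int_A^{*} f\,d(\nu_2,\mu).$$
   Context: $\mathbb{R}_0^+=[0,\infty)$. $S$ is a nonempty, at least countable set, $\mathcal{C}$ is a $\sigma$-algebra of subsets of $S$, and $\mathcal{E}$ is a $\sigma$-algebra of subsets of $\mathbb{R}_0^+$ with $\{0\}\in\mathcal{E}$. Set functions on $\mathcal{C}$ and $\mathcal{E}$ have values in $\mathbb{R}_0^+$, vanish on $\emptyset$, and are not assumed additive or monotone unless stated. Below, $\nu$ denotes any such set function on $\mathcal{E}$. Measurability: $f:S\to\mathbb{R}_0^+$ is $\mu$-measurable if it is $\mathcal{C}$-measurable, i.e. $E_f^\alpha:=\{s\in S: f(s)\ge\alpha\}\in\mathcal{C}$ for all $\alpha\ge 0$. Riemann-Lebesgue (RL) integral: for two countable partitions $P,P'$ of $\mathbb{R}_0^+$, $P'$ is finer than $P$ if every set of $P'$ is included in some set of $P$. A function $g:\mathbb{R}_0^+\to\mathbb{R}$ is $\nu$-RL integrable if there is $a\in\mathbb{R}$ such that for every $\varepsilon>0$ there is a countable partition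 $\Pi_\varepsilon$ of $\mathbb{R}_0^+$ into sets of $\mathcal{E}$ such that for every countable partition $\Pi=(E_n)_n$ of $\mathbb{R}_0^+$ into sets of $\mathcal{E}$ finer than $\Pi_\varepsilon$: $g$ is bounded on every $E_n$ with $\nu(E_n)>0$, and for every choice of $s_n\in E_n$ the series $\sum_n g(s_n)\nu(E_n)$ converges absolutely and $|\sum_n g(s_n)\nu(E_n)-a|<\varepsilon$. Then $a$ is unique and is denoted $(RL)\int_{[0,\infty)}g\,d\nu$. Generalized decomposition integral: for a $\mu$-measurable $f:S\to\mathbb{R}_0^+$ and $A\in\mathcal{C}$ put $u_{f,\mu}^{A}(\alpha)=\mu(E_f^\alpha\cap A)$, $\alpha\ge 0$. $f$ is $(\nu,\mu)$-integrable on $A$ if $u_{f,\mu}^A$ is $\nu$-RL integrable on $\mathbb{R}_0^+$, and then $\int_A^{*}f\,d(\nu,\mu):=(RL)\int_{[0,\infty)}u_{f,\mu}^A\,d\nu$. $G_{RL}(\nu,\mu,A)$ is the set of all $\mu$-measurable $f:S\to\mathbb{R}_0^+$ that are $(\nu,\mu)$-integrable on $A$ (with finite integral). *)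

theory Defs
  imports "HOL-Analysis.Analysis"
begin

definition set_function :: "'a set set \<Rightarrow> ('a set \<Rightarrow> real) \<Rightarrow> bool" where
  "set_function \<A> \<mu> \<longleftrightarrow> \<mu> {} = 0 \<and> (\<forall>B\<in>\<A>. 0 \<le> \<mu> B)"

text \<open>
  Countable means finite or countably infinite, and the members of a partition are nonempty
  (this is part of the library predicate), so that a point can be chosen in each of them.
\<close>

definition countable_partition :: "real set set \<Rightarrow> real set set \<Rightarrow> bool" where
  "countable_partition \<E> P \<longleftrightarrow> partition_on {0..} P \<and> countable P \<and> P \<subseteq> \<E>"

text \<open>
  The partition is treated as a set, so a choice of points is a function \<open>s\<close> on its members, and the
  series is an unordered sum. Since absolute convergence is demanded, its value is that of the
  series for any enumeration of the partition. Only the values of \<open>g\<close> on \<open>{0..}\<close> matter.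
\<close>

definition has_RL_integral ::
    "real set set \<Rightarrow> (real set \<Rightarrow> real) \<Rightarrow> (real \<Rightarrow> real) \<Rightarrow> real \<Rightarrow> bool" where
  "has_RL_integral \<E> \<nu> g a \<longleftrightarrow>
     (\<forall>\<epsilon>>0. \<exists>P. countable_partition \<E> P \<and>
        (\<forall>Q. countable_partition \<E> Q \<and> refines {0..} Q P \<longrightarrow>
           (\<forall>E\<in>Q. \<nu> E > 0 \<longrightarrow> bounded (g ` E)) \<and>
           (\<forall>s. (\<forall>E\<in>Q. s E \<in> E) \<longrightarrow>
              (\<lambda>E. \<bar>g (s E) * \<nu> E\<bar>) summable_on Q \<and>
              \<bar>(\<Sum>\<^sub>\<infinity>E\<in>Q. g (s E) * \<nu> E) - a\<bar> < \<epsilon>)))"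

definition RL_integrable :: "real set set \<Rightarrow> (real set \<Rightarrow> real) \<Rightarrow> (real \<Rightarrow> real) \<Rightarrow> bool" where
  "RL_integrable \<E> \<nu> g \<longleftrightarrow> (\<exists>a. has_RL_integral \<E> \<nu> g a)"

definition RL_integral :: "real set set \<Rightarrow> (real set \<Rightarrow> real) \<Rightarrow> (real \<Rightarrow> real) \<Rightarrow> real" where
  "RL_integral \<E> \<nu> g = (THE a. has_RL_integral \<E> \<nu> g a)"

definition upper_level :: "'a set \<Rightarrow> ('a \<Rightarrow> real) \<Rightarrow> real \<Rightarrow> 'a set" where
  "upper_level S f \<alpha> = {s \<in> S. \<alpha> \<le> f s}"

definition level_measurable :: "'a set \<Rightarrow> 'a set set \<Rightarrow> ('a \<Rightarrow> real) \<Rightarrow> bool" where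
  "level_measurable S \<C> f \<longleftrightarrow> (\<forall>\<alpha>\<ge>0. upper_level S f \<alpha> \<in> \<C>)"

definition level_fun ::
    "'a set \<Rightarrow> ('a set \<Rightarrow> real) \<Rightarrow> 'a set \<Rightarrow> ('a \<Rightarrow> real) \<Rightarrow> real \<Rightarrow> real" where
  "level_fun S \<mu> A f \<alpha> = \<mu> (upper_level S f \<alpha> \<inter> A)"

definition G_RL ::
    "'a set \<Rightarrow> 'a set set \<Rightarrow> real set set \<Rightarrow> (real set \<Rightarrow> real) \<Rightarrow> ('a set \<Rightarrow> real) \<Rightarrow> 'a set
      \<Rightarrow> ('a \<Rightarrow> real) set" where
  "G_RL S \<C> \<E> \<nu> \<mu> A =
     {f \<in> S \<rightarrow> {0..}. level_measurable S \<C> f \<and> RL_integrable \<E> \<nu> (level_fun S \<mu> A f)}"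

definition decomposition_integral ::
    "'a set \<Rightarrow> real set set \<Rightarrow> (real set \<Rightarrow> real) \<Rightarrow> ('a set \<Rightarrow> real) \<Rightarrow> 'a set
      \<Rightarrow> ('a \<Rightarrow> real) \<Rightarrow> real" where
  "decomposition_integral S \<E> \<nu> \<mu> A f = RL_integral \<E> \<nu> (level_fun S \<mu> A f)"

end

theory Submission
  imports Defs
begin

text \<open>For a fixed partition and fixed sample points, the Riemann-Lebesgue sum is linear in the
  set function, so sums within \<open>\<epsilon> / 2\<close> of \<open>a\<close> for
  \<open>\<nu>\<^sub>1\<close> and of \<open>b\<close> for \<open>\<nu>\<^sub>2\<close> add up to a
  sum within \<open>\<epsilon>\<close> of \<open>a + b\<close>. The two integrals come with
  different threshold partitions, and a common refinement reconciles them: its members are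
  intersections, so it stays countable and inside the sigma-algebra \<open>\<E>\<close>. The same
  device shows that the integral is unique, which turns the statement about
  \<open>has_RL_integral\<close> into an equation between integrals. The integrand
  \<open>level_fun S \<mu> A f\<close> depends on \<open>\<mu>\<close>, \<open>f\<close> and
  \<open>A\<close> but not on the \<open>\<nu>\<close>'s, so the argument runs for an arbitrary
  \<open>g\<close>. The core is \<open>has_RL_integral_common_partition\<close> and
  \<open>RL_sums_near_add_measure\<close>.\<close>

lemma countable_partition_common_refinement:
  assumes "Int_stable \<E>" "countable_partition \<E> P" "countable_partition \<E> Q"
  obtains R where "countable_partition \<E> R" "refines {0..} R P" "refines {0..} R Q"
proof
  let ?R = "common_refinement {P, Q}"
  have part: "partition_on {0..} X" if "X \<in> {P, Q}" for X
    using assms that by (auto simp: countable_partition_def)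
  \<comment> \<open>An inclusion suffices, as countability and membership in \<open>\<E>\<close>
    pass to subsets; the image may contain the empty set, which \<open>?R\<close> discards.\<close>
  have "?R \<subseteq> (\<lambda>(X, Y). X \<inter> Y) ` (P \<times> Q)"
    by (force simp: common_refinement)
  moreover have "countable ((\<lambda>(X, Y). X \<inter> Y) ` (P \<times> Q))"
    using assms(2,3) by (intro countable_image countable_SIGMA) (auto simp: countable_partition_def)
  moreover have "(\<lambda>(X, Y). X \<inter> Y) ` (P \<times> Q) \<subseteq> \<E>"
    using assms by (auto simp: countable_partition_def Int_stable_def)
  ultimately have "countable ?R" "?R \<subseteq> \<E>"
    by (meson countable_subset order_trans)+
  then show "countable_partition \<E> ?R"
    using partition_on_common_refinement[of "{P, Q}", OF part] by (simp add: countable_partition_def)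
  show "refines {0..} ?R P" "refines {0..} ?R Q"
    using refines_common_refinement[of "{P, Q}", OF part] by simp_all
qed

text \<open>This isolates the condition that \<open>has_RL_integral\<close> puts on a single fine
  partition, so that additivity can be proved one partition at a time.\<close>

definition RL_sums_near ::
    "(real set \<Rightarrow> real) \<Rightarrow> (real \<Rightarrow> real) \<Rightarrow> real \<Rightarrow> real \<Rightarrow> real set set \<Rightarrow> bool" where
  "RL_sums_near \<nu> g a \<epsilon> Q \<longleftrightarrow>
     (\<forall>E\<in>Q. \<nu> E > 0 \<longrightarrow> bounded (g ` E)) \<and>
     (\<forall>s. (\<forall>E\<in>Q. s E \<in> E) \<longrightarrow>
        (\<lambda>E. \<bar>g (s E) * \<nu> E\<bar>) summable_on Q \<and>
        \<bar>(\<Sum>\<^sub>\<infinity>E\<in>Q. g (s E) * \<nu> E) - a\<bar> < \<epsilon>)"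

lemma has_RL_integral_iff:
  "has_RL_integral \<E> \<nu> g a \<longleftrightarrow>
     (\<forall>\<epsilon>>0. \<exists>P. countable_partition \<E> P \<and>
        (\<forall>Q. countable_partition \<E> Q \<and> refines {0..} Q P \<longrightarrow> RL_sums_near \<nu> g a \<epsilon> Q))"
  unfolding has_RL_integral_def RL_sums_near_def by (rule refl)

text \<open>Whatever is finer than a common refinement of the two thresholds is finer than each, by
  transitivity. Uniqueness uses this with one set function and two candidate values, additivity with
  two set functions.\<close>

lemma has_RL_integral_common_partition:
  assumes "Int_stable \<E>" "has_RL_integral \<E> \<nu>\<^sub>1 g a" "has_RL_integral \<E> \<nu>\<^sub>2 g b" "\<epsilon> > 0"
  obtains P where "countable_partition \<E> P"
    "\<forall>Q. countable_partition \<E> Q \<and> refines {0..} Q P \<longrightarrow>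
      RL_sums_near \<nu>\<^sub>1 g a \<epsilon> Q \<and> RL_sums_near \<nu>\<^sub>2 g b \<epsilon> Q"
proof -
  obtain P\<^sub>1 where P\<^sub>1: "countable_partition \<E> P\<^sub>1"
    "\<forall>Q. countable_partition \<E> Q \<and> refines {0..} Q P\<^sub>1 \<longrightarrow> RL_sums_near \<nu>\<^sub>1 g a \<epsilon> Q"
    using assms(2,4) unfolding has_RL_integral_iff by blast
  obtain P\<^sub>2 where P\<^sub>2: "countable_partition \<E> P\<^sub>2"
    "\<forall>Q. countable_partition \<E> Q \<and> refines {0..} Q P\<^sub>2 \<longrightarrow> RL_sums_near \<nu>\<^sub>2 g b \<epsilon> Q"
    using assms(3,4) unfolding has_RL_integral_iff by blast
  obtain R where R: "countable_partition \<E> R" "refines {0..} R P\<^sub>1" "refines {0..} R P\<^sub>2"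
    by (rule countable_partition_common_refinement[OF assms(1) P\<^sub>1(1) P\<^sub>2(1)])
  show thesis
  proof (rule that[OF R(1)], intro allI impI, elim conjE)
    fix Q assume Q: "countable_partition \<E> Q" "refines {0..} Q R"
    then show "RL_sums_near \<nu>\<^sub>1 g a \<epsilon> Q \<and> RL_sums_near \<nu>\<^sub>2 g b \<epsilon> Q"
      using P\<^sub>1(2) P\<^sub>2(2) refines_trans[OF Q(2) R(2)] refines_trans[OF Q(2) R(3)] by simp
  qed
qed

lemma has_RL_integral_unique:
  assumes "Int_stable \<E>" "has_RL_integral \<E> \<nu> g a" "has_RL_integral \<E> \<nu> g b"
  shows "a = b"
proof (rule ccontr)
  assume "a \<noteq> b"
  \<comment> \<open>At this radius the open intervals around \<open>a\<close> and \<open>b\<close>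
    are disjoint, so no sum can lie in both.\<close>
  then have \<epsilon>: "\<bar>a - b\<bar> / 2 > 0"
    by simp
  obtain P where P: "countable_partition \<E> P"
    and near: "\<forall>Q. countable_partition \<E> Q \<and> refines {0..} Q P \<longrightarrow>
      RL_sums_near \<nu> g a (\<bar>a - b\<bar> / 2) Q \<and> RL_sums_near \<nu> g b (\<bar>a - b\<bar> / 2) Q"
    by (rule has_RL_integral_common_partition[OF assms \<epsilon>])
  have "refines {0..} P P"
    using P by (simp add: countable_partition_def refines_refl)
  with P near have near: "RL_sums_near \<nu> g a (\<bar>a - b\<bar> / 2) P" "RL_sums_near \<nu> g b (\<bar>a - b\<bar> / 2) P"
    by simp_all
  \<comment> \<open>The estimates speak about choices of points, so one choice must be exhibited; it
    exists because members of a partition are nonempty.\<close>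
  define s where "s E = (SOME x. x \<in> E)" for E :: "real set"
  have "\<forall>E\<in>P. s E \<in> E"
    using P by (auto simp: s_def countable_partition_def partition_on_def some_in_eq)
  then have "\<bar>(\<Sum>\<^sub>\<infinity>E\<in>P. g (s E) * \<nu> E) - a\<bar> < \<bar>a - b\<bar> / 2"
    "\<bar>(\<Sum>\<^sub>\<infinity>E\<in>P. g (s E) * \<nu> E) - b\<bar> < \<bar>a - b\<bar> / 2"
    using near unfolding RL_sums_near_def by blast+
  then show False
    by (auto simp: abs_if field_simps split: if_splits)
qed

lemma RL_integral_eq:
  assumes "Int_stable \<E>" "has_RL_integral \<E> \<nu> g a"
  shows "RL_integral \<E> \<nu> g = a"
  unfolding RL_integral_def
  by (rule the_equality) (use assms has_RL_integral_unique in blast)+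

lemma RL_sums_near_add_measure:
  assumes near: "RL_sums_near \<nu>\<^sub>1 g a \<delta> Q" "RL_sums_near \<nu>\<^sub>2 g b \<epsilon> Q"
  shows "RL_sums_near (\<lambda>E. \<nu>\<^sub>1 E + \<nu>\<^sub>2 E) g (a + b) (\<delta> + \<epsilon>) Q"
  unfolding RL_sums_near_def
proof (intro conjI ballI allI impI)
  fix E assume "E \<in> Q" "\<nu>\<^sub>1 E + \<nu>\<^sub>2 E > 0"
  \<comment> \<open>A positive sum has a positive summand, and the hypothesis for that set function
    bounds \<open>g\<close> on \<open>E\<close>.\<close>
  moreover from this have "\<nu>\<^sub>1 E > 0 \<or> \<nu>\<^sub>2 E > 0"
    by linarith
  ultimately show "bounded (g ` E)"
    using near unfolding RL_sums_near_def by blast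
next
  fix s assume "\<forall>E\<in>Q. s E \<in> E"
  then have abs_summable: "(\<lambda>E. \<bar>g (s E) * \<nu>\<^sub>1 E\<bar>) summable_on Q" "(\<lambda>E. \<bar>g (s E) * \<nu>\<^sub>2 E\<bar>) summable_on Q"
    and close: "\<bar>(\<Sum>\<^sub>\<infinity>E\<in>Q. g (s E) * \<nu>\<^sub>1 E) - a\<bar> < \<delta>" "\<bar>(\<Sum>\<^sub>\<infinity>E\<in>Q. g (s E) * \<nu>\<^sub>2 E) - b\<bar> < \<epsilon>"
    using near unfolding RL_sums_near_def by blast+
  have summable: "(\<lambda>E. g (s E) * \<nu>\<^sub>1 E) summable_on Q" "(\<lambda>E. g (s E) * \<nu>\<^sub>2 E) summable_on Q"
    using abs_summable by (simp_all add: abs_summable_summable)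
  have "(\<lambda>E. g (s E) * (\<nu>\<^sub>1 E + \<nu>\<^sub>2 E)) summable_on Q"
    using summable_on_add[OF summable] by (simp only: distrib_left)
  \<comment> \<open>For real families unordered summability is already absolute, so summability of
    the termwise sum is enough.\<close>
  then show "(\<lambda>E. \<bar>g (s E) * (\<nu>\<^sub>1 E + \<nu>\<^sub>2 E)\<bar>) summable_on Q"
    by (simp add: summable_on_iff_abs_summable_on_real[THEN iffD1, unfolded real_norm_def])
  have "(\<Sum>\<^sub>\<infinity>E\<in>Q. g (s E) * (\<nu>\<^sub>1 E + \<nu>\<^sub>2 E)) = (\<Sum>\<^sub>\<infinity>E\<in>Q. g (s E) * \<nu>\<^sub>1 E) + (\<Sum>\<^sub>\<infinity>E\<in>Q. g (s E) * \<nu>\<^sub>2 E)"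
    using infsum_add[OF summable] by (simp only: distrib_left)
  then show "\<bar>(\<Sum>\<^sub>\<infinity>E\<in>Q. g (s E) * (\<nu>\<^sub>1 E + \<nu>\<^sub>2 E)) - (a + b)\<bar> < \<delta> + \<epsilon>"
    using close by linarith
qed

lemma has_RL_integral_add_measure:
  assumes "Int_stable \<E>" "has_RL_integral \<E> \<nu>\<^sub>1 g a" "has_RL_integral \<E> \<nu>\<^sub>2 g b"
  shows "has_RL_integral \<E> (\<lambda>E. \<nu>\<^sub>1 E + \<nu>\<^sub>2 E) g (a + b)"
  unfolding has_RL_integral_iff
proof (intro allI impI)
  fix \<epsilon> :: real assume "\<epsilon> > 0"
  then have \<epsilon>: "\<epsilon> / 2 > 0"
    by simp
  obtain P where P: "countable_partition \<E> P"
    and near: "\<forall>Q. countable_partition \<E> Q \<and> refines {0..} Q P \<longrightarrow>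
      RL_sums_near \<nu>\<^sub>1 g a (\<epsilon> / 2) Q \<and> RL_sums_near \<nu>\<^sub>2 g b (\<epsilon> / 2) Q"
    by (rule has_RL_integral_common_partition[OF assms \<epsilon>])
  have "RL_sums_near (\<lambda>E. \<nu>\<^sub>1 E + \<nu>\<^sub>2 E) g (a + b) \<epsilon> Q"
    if "countable_partition \<E> Q" "refines {0..} Q P" for Q
    using RL_sums_near_add_measure[of \<nu>\<^sub>1 g a "\<epsilon> / 2" Q \<nu>\<^sub>2 b "\<epsilon> / 2"] near that by simp
  with P show "\<exists>P. countable_partition \<E> P \<and>
      (\<forall>Q. countable_partition \<E> Q \<and> refines {0..} Q P \<longrightarrow>
        RL_sums_near (\<lambda>E. \<nu>\<^sub>1 E + \<nu>\<^sub>2 E) g (a + b) \<epsilon> Q)"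
    by blast
qed

theorem proposition3p17:
  fixes S :: "'a set" and \<C> :: "'a set set" and \<E> :: "real set set"
    and \<mu> :: "'a set \<Rightarrow> real" and \<nu>\<^sub>1 \<nu>\<^sub>2 :: "real set \<Rightarrow> real"
    and f :: "'a \<Rightarrow> real" and A :: "'a set"
  assumes "S \<noteq> {}" and "infinite S"
    and "sigma_algebra S \<C>"
    and "sigma_algebra {0..} \<E>" and "{0} \<in> \<E>"
    and "set_function \<C> \<mu>" and "set_function \<E> \<nu>\<^sub>1" and "set_function \<E> \<nu>\<^sub>2"
    and "f \<in> S \<rightarrow> {0..}" and "level_measurable S \<C> f"
    and "A \<in> \<C>"
    and "f \<in> G_RL S \<C> \<E> \<nu>\<^sub>1 \<mu> A" and "f \<in> G_RL S \<C> \<E> \<nu>\<^sub>2 \<mu> A"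
  shows "f \<in> G_RL S \<C> \<E> (\<lambda>E. \<nu>\<^sub>1 E + \<nu>\<^sub>2 E) \<mu> A \<and>
    decomposition_integral S \<E> (\<lambda>E. \<nu>\<^sub>1 E + \<nu>\<^sub>2 E) \<mu> A f =
      decomposition_integral S \<E> \<nu>\<^sub>1 \<mu> A f + decomposition_integral S \<E> \<nu>\<^sub>2 \<mu> A f"
proof -
  interpret \<E>: sigma_algebra "{0..}" \<E>
    by fact
  \<comment> \<open>Closure under intersections keeps common refinements inside
    \<open>\<E>\<close>.\<close>
  have stable: "Int_stable \<E>"
    by (simp add: Int_stable_def \<E>.Int)
  obtain a b where ab: "has_RL_integral \<E> \<nu>\<^sub>1 (level_fun S \<mu> A f) a"
      "has_RL_integral \<E> \<nu>\<^sub>2 (level_fun S \<mu> A f) b"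
    using assms(12,13) by (auto simp: G_RL_def RL_integrable_def)
  \<comment> \<open>\<open>sum\<close> gives integrability for the added set functions and, through
    uniqueness, also the value of the integral.\<close>
  note sum = has_RL_integral_add_measure[OF stable ab]
  show ?thesis
    using assms(9,10) ab[THEN RL_integral_eq[OF stable]] sum RL_integral_eq[OF stable sum]
    by (auto simp: G_RL_def RL_integrable_def decomposition_integral_def)
qed

end
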